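(* Let the channel be in any one of the three cases described in the context, and let $P_c>0$ vary with all other parameters fixed. When $P_c$ increases: (1) $\mathcal{E}^\star$ strictly increases. (2) $s^\star$ strictly increases. Moreover, $\lim_{P_c\to+\infty}s^\star=+\infty$ and $\lim_{P_c\to0}s^\star=0$.
   Context: Constants: bandwidth $B>0$, noise variance $\sigma^2>0$, power-amplifier efficiency $\xi>0$, rate-independent circuit power $P_c>0$, coefficient $\kappa\ge 0$. The function $\phi:[0,\infty)\to\mathbb{R}$ satisfies $\phi(0)=0$ and is differentiable, strictly increasing and (not necessarily strictly) convex on $[0,\infty)$. The function $\rho(s)$, $s\ge 0$ (minimum transmission power needed to achieve spectral efficiency $s$, divided by $\sigma^2$) is defined in three cases. Case 1 (static channel, transmitter knows the channel): $G>0$ is a constant and $\rho(s)=\min\{p\ge0:\log_2(1+Gp)\ge s\}=\frac1G(2^s-1)$. Case 2 (fast-varying channel, transmitter knows its distribution): $G\ge0$ is a random variable with a probability density function and $\rho(s)=\min\{p\ge 0:\mathbb{E}_G[\log_2(1+Gp)]\ge s\}$. Case 3 (fast-varying channel, transmitter knows the channel): $G$ is a random variable as in Case 2 and $\rho(s)=\min \mathbb{E}_G[p(G)]$ over all nonnegative (measurable) functions $p(\cdot)$ on $[0,\infty)$ satisfying $\mathbb{E}_G[\log_2(1+Gp(G))]\ge s$. In Cases 2 and 3, $\mathbb{E}_G[\log_2(1+Gp)]<\infty$ for every constant $p\ge0$. Minimum total power: $P(s)=\kappa\phi(Bs)+\frac{\sigma^2}{\xi}\rho(s)+P_c$. Energy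 per bit (the energy efficiency; smaller is better): $\mathcal{E}(s)=\frac{P(s)}{Bs}$ for $s>0$, with $\mathcal{E}(0)=+\infty$. The optimum value is $\mathcal{E}^\star=\min_{s\ge0}\mathcal{E}(s)$ and $s^\star$ is the (unique) minimizer; both are regarded as functions of the parameters. *)

theory Defs
  imports "HOL-Probability.Probability"
begin

(* Mean spectral efficiency E[log2(1 + G p(G))] of the power allocation p.  The integrand is
   nonnegative (G and p are), and the expectation may be infinite, so it is taken in ennreal. *)
definition mean_rate :: "'a measure \<Rightarrow> ('a \<Rightarrow> real) \<Rightarrow> (real \<Rightarrow> real) \<Rightarrow> ennreal" where
  "mean_rate M G p = (\<integral>\<^sup>+ \<omega>. ennreal (log 2 (1 + G \<omega> * p (G \<omega>))) \<partial>M)"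

(* Static: constant gain, known to the transmitter.
   Fast_Distribution: random gain, the transmitter knows only its distribution.
   Fast_State: random gain, the transmitter knows its realisation. *)
datatype 'a channel =
    Static real
  | Fast_Distribution "'a measure" "'a \<Rightarrow> real"
  | Fast_State "'a measure" "'a \<Rightarrow> real"

definition random_gain :: "'a measure \<Rightarrow> ('a \<Rightarrow> real) \<Rightarrow> bool" where
  "random_gain M G \<longleftrightarrow>
     prob_space M \<and>
     (\<forall>\<omega>\<in>space M. 0 \<le> G \<omega>) \<and>
     (\<exists>f. distributed M lborel G f) \<and>
     (\<forall>p\<ge>0. mean_rate M G (\<lambda>_. p) < \<infinity>)"

fun valid_channel :: "'a channel \<Rightarrow> bool" where
  "valid_channel (Static G) \<longleftrightarrow> 0 < G"
| "valid_channel (Fast_Distribution M G) \<longleftrightarrow> random_gain M G"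
| "valid_channel (Fast_State M G) \<longleftrightarrow> random_gain M G"

definition power_allocation :: "(real \<Rightarrow> real) \<Rightarrow> bool" where
  "power_allocation p \<longleftrightarrow>
     p \<in> borel_measurable (restrict_space borel {0..}) \<and> (\<forall>g\<ge>0. 0 \<le> p g)"

(* Only meaningful for s >= 0.  In the last case the candidate values E[p(G)] may be infinite,
   so the minimum is formed in ennreal; it is finite for a valid channel. *)
fun rho :: "'a channel \<Rightarrow> real \<Rightarrow> real" where
  "rho (Static G) s = (LEAST p. 0 \<le> p \<and> s \<le> log 2 (1 + G * p))"
| "rho (Fast_Distribution M G) s = (LEAST p. 0 \<le> p \<and> ennreal s \<le> mean_rate M G (\<lambda>_. p))"
| "rho (Fast_State M G) s =
     enn2real (LEAST e. \<exists>p. power_allocation p \<and> ennreal s \<le> mean_rate M G p \<and>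
                            e = (\<integral>\<^sup>+ \<omega>. ennreal (p (G \<omega>)) \<partial>M))"

definition total_power ::
  "real \<Rightarrow> real \<Rightarrow> real \<Rightarrow> real \<Rightarrow> (real \<Rightarrow> real) \<Rightarrow> 'a channel \<Rightarrow> real \<Rightarrow> real \<Rightarrow> real" where
  "total_power B \<sigma> \<xi> \<kappa> \<phi> ch Pc s = \<kappa> * \<phi> (B * s) + \<sigma>\<^sup>2 / \<xi> * rho ch s + Pc"

definition energy_per_bit ::
  "real \<Rightarrow> real \<Rightarrow> real \<Rightarrow> real \<Rightarrow> (real \<Rightarrow> real) \<Rightarrow> 'a channel \<Rightarrow> real \<Rightarrow> real \<Rightarrow> ereal" where
  "energy_per_bit B \<sigma> \<xi> \<kappa> \<phi> ch Pc s =
     (if s = 0 then \<infinity> else ereal (total_power B \<sigma> \<xi> \<kappa> \<phi> ch Pc s / (B * s)))"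

definition E_star ::
  "real \<Rightarrow> real \<Rightarrow> real \<Rightarrow> real \<Rightarrow> (real \<Rightarrow> real) \<Rightarrow> 'a channel \<Rightarrow> real \<Rightarrow> ereal" where
  "E_star B \<sigma> \<xi> \<kappa> \<phi> ch Pc = (LEAST e. \<exists>s\<ge>0. e = energy_per_bit B \<sigma> \<xi> \<kappa> \<phi> ch Pc s)"

definition s_star ::
  "real \<Rightarrow> real \<Rightarrow> real \<Rightarrow> real \<Rightarrow> (real \<Rightarrow> real) \<Rightarrow> 'a channel \<Rightarrow> real \<Rightarrow> real" where
  "s_star B \<sigma> \<xi> \<kappa> \<phi> ch Pc =
     (THE s. is_arg_min (energy_per_bit B \<sigma> \<xi> \<kappa> \<phi> ch Pc) (\<lambda>s. 0 \<le> s) s)"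

end

theory Submission imports Defs "HOL-Real_Asymp.Real_Asymp" begin

text \<open>Write \<open>h(s) = P(s) - P\<^sub>c\<close>. In each case \<open>h\<close> has a continuous, strictly increasing and
  unbounded subgradient \<open>d\<close> on the positive half-line: \<open>\<rho>\<close> is explicit in Case 1, the inverse of
  the concave mean rate in Case 2, and given by water filling in Case 3, where the subgradient is
  the water level up to the factor \<open>ln 2\<close>. Hence \<open>F(s) = s d(s) - h(s)\<close> is a strictly increasing
  bijection of the positive half-line. A point \<open>s\<close> minimises \<open>(h(s) + P\<^sub>c) / (B s)\<close> iff \<open>F(s) = P\<^sub>c\<close>, so
  the minimiser is \<open>F\<close> inverted at \<open>P\<^sub>c\<close>, and the minimum is \<open>d / B\<close> at that point.\<close>

section \<open>Convex functions with a continuous strictly increasing subgradient\<close>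

text \<open>\<open>d\<close> plays the role of the derivative of \<open>h\<close>. The subgradient
  inequality suits the random channels better than a derivative would: there it comes from inverting
  a concave rate or from Lagrangian duality.\<close>

locale strict_subgradient =
  fixes h d :: "real \<Rightarrow> real"
  assumes zero: "h 0 = 0"
    and nonneg: "0 \<le> s \<Longrightarrow> 0 \<le> h s"
    and subgradient: "0 < s \<Longrightarrow> 0 \<le> t \<Longrightarrow> h s + d s * (t - s) \<le> h t"
    and strict: "0 < s \<Longrightarrow> s < t \<Longrightarrow> d s < d t"
    and continuous: "continuous_on {0<..} d"
    and unbounded: "filterlim d at_top at_top"
begin

text \<open>This is the convex conjugate of \<open>h\<close> at the slope \<open>d s\<close>.
  Formally, \<open>(h s + c) / s\<close> has derivative \<open>(intercept s - c) / s^2\<close>, so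
  its critical point solves \<open>intercept s = c\<close>.\<close>

definition intercept :: "real \<Rightarrow> real" where
  "intercept s = s * d s - h s"

text \<open>The subgradient inequality at \<open>t\<close>, tested at \<open>s\<close>. It turns
  growth of \<open>d\<close> into growth of \<open>intercept\<close>, for strictness and for
  unboundedness alike.\<close>

lemma intercept_diff:
  assumes "0 < s" "0 < t"
  shows "s * (d t - d s) \<le> intercept t - intercept s"
  using subgradient[of t s] assms by (simp add: intercept_def algebra_simps)

lemma intercept_strict:
  assumes "0 < s" "s < t"
  shows "intercept s < intercept t"
proof -
  have "0 < s * (d t - d s)"
    using assms strict by simp
  then show ?thesis
    using intercept_diff[of s t] assms by linarith
qed

lemma intercept_less_iff:
  assumes "0 < s" "0 < t"
  shows "intercept s < intercept t \<longleftrightarrow> s < t"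
  using assms intercept_strict by (metis linorder_neqE_linordered_idom order_less_asym)

lemma intercept_pos:
  assumes "0 < s"
  shows "0 < intercept s"
proof -
  \<comment> \<open>Testing at 0 gives only a weak inequality; moving on from \<open>s/2\<close> to
    \<open>s\<close> makes it strict.\<close>
  have "0 \<le> intercept (s/2)"
    using subgradient[of "s/2" 0] assms zero by (simp add: intercept_def algebra_simps)
  also have "\<dots> < intercept s"
    using assms by (intro intercept_strict) auto
  finally show ?thesis .
qed

text \<open>Near \<open>s\<close>, \<open>h t\<close> lies above the tangent at \<open>s\<close>
  and, by the inequality at \<open>t\<close> tested at \<open>s\<close>, below
  \<open>h s + d t * (t - s)\<close>. Both bounds tend to \<open>h s\<close>, the second by
  continuity of \<open>d\<close>.\<close>

lemma continuous_h: "continuous_on {0<..} h"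
proof -
  have "isCont h s" if s: "0 < s" for s
  proof -
    have ev: "\<forall>\<^sub>F t in at s. 0 < t"
      using s by (intro eventually_at_in_open[of "{0<..}" s, THEN eventually_mono]) auto
    have d: "(d \<longlongrightarrow> d s) (at s)"
      using continuous s by (simp add: continuous_on_eq_continuous_at isCont_def)
    have 1: "((\<lambda>t. h s + d s * (t - s)) \<longlongrightarrow> h s + d s * (s - s)) (at s)"
      by (intro tendsto_intros)
    have 2: "((\<lambda>t. h s + d t * (t - s)) \<longlongrightarrow> h s + d s * (s - s)) (at s)"
      by (intro tendsto_intros d)
    have "(h \<longlongrightarrow> h s) (at s)"
    proof (rule tendsto_sandwich)
      show "\<forall>\<^sub>F t in at s. h s + d s * (t - s) \<le> h t"
        using ev by eventually_elim (use subgradient s in auto)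
      show "\<forall>\<^sub>F t in at s. h t \<le> h s + d t * (t - s)"
      proof (use ev in eventually_elim)
        case (elim t)
        then show ?case
          using subgradient[of t s] s by (simp add: algebra_simps)
      qed
    qed (use 1 2 in auto)
    then show ?thesis
      by (simp add: isCont_def)
  qed
  then show ?thesis
    by (simp add: continuous_at_imp_continuous_on)
qed

lemma intercept_surj:
  assumes "0 < c"
  shows "\<exists>s>0. intercept s = c"
proof -
  \<comment> \<open>\<open>a \<le> 1\<close> gives \<open>d a \<le> d 1\<close>, and the quotient
    then makes \<open>a * d a\<close> at most \<open>c\<close>.\<close>
  define a where "a = min 1 (c / (\<bar>d 1\<bar> + 1))"
  have a: "0 < a" "a \<le> 1"
    using assms by (auto simp: a_def)
  have "d a \<le> d 1"
    using strict[of a 1] a by (cases "a = 1") auto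
  then have "a * d a \<le> a * (\<bar>d 1\<bar> + 1)"
    using a by (intro mult_left_mono) auto
  also have "\<dots> \<le> c"
    using min.cobounded2[of 1 "c / (\<bar>d 1\<bar> + 1)"]
    by (simp add: a_def[symmetric] pos_le_divide_eq)
  finally have lo: "intercept a \<le> c"
    using nonneg[of a] a by (simp add: intercept_def)
  \<comment> \<open>The bound on \<open>d b\<close> is what \<open>intercept_diff\<close> from 1 to
    \<open>b\<close> needs to reach \<open>c\<close>.\<close>
  obtain b where b: "1 < b" "c - intercept 1 + d 1 \<le> d b"
    using eventually_conj[OF eventually_gt_at_top[of 1]
        filterlim_at_top[THEN iffD1, OF unbounded, rule_format]]
    by (metis (mono_tags, lifting) eventually_at_top_linorder order_refl)
  have hi: "c \<le> intercept b"
    using intercept_diff[of 1 b] b by simp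
  have "continuous_on {a..b} intercept"
    unfolding intercept_def using a
    by (intro continuous_intros continuous_on_subset[OF continuous]
        continuous_on_subset[OF continuous_h]) auto
  then obtain s where "a \<le> s" "intercept s = c"
    using IVT'[of intercept a c b] lo hi a b by auto
  then show ?thesis
    using a by (intro exI[of _ s]) auto
qed

text \<open>The tangent at \<open>s\<close> meets the vertical axis at height \<open>- intercept s\<close>, so adding
  \<open>intercept s\<close> turns it into a line through the origin.\<close>

lemma line_le:
  assumes "0 < s" "0 \<le> t" "t \<noteq> s"
  shows "d s * t < h t + intercept s"
proof -
  \<comment> \<open>Strictness comes from a detour: follow the tangent at \<open>s\<close> to the
    midpoint, then the tangent at the midpoint to \<open>t\<close>. The second slope differs
    strictly from \<open>d s\<close>, in the favourable direction on either side.\<close>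
  define u where "u = (s + t) / 2"
  have u: "0 < u"
    using assms by (simp add: u_def)
  have "h s + d s * (u - s) + d u * (t - u) \<le> h t"
    using subgradient[of s u] subgradient[of u t] u assms by simp
  moreover have "d s * (t - u) < d u * (t - u)"
  proof (cases "s < t")
    case True
    then show ?thesis
      using strict[of s u] assms by (intro mult_strict_right_mono) (auto simp: u_def)
  next
    case False
    then show ?thesis
      using strict[of u s] assms u by (intro mult_strict_right_mono_neg) (auto simp: u_def)
  qed
  ultimately show ?thesis
    by (simp add: intercept_def algebra_simps)
qed

end

section \<open>Inverting rate functions\<close>

text \<open>Strict growth is assumed only where \<open>R\<close> is positive, because the
  water-filling rate may vanish up to a positive water level. Accordingly \<open>w\<close> inverts
  \<open>R\<close> at positive values only.\<close>

lemma rate_inverse: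
  fixes R :: "real \<Rightarrow> real"
  assumes cont: "continuous_on {0..} R" and zero: "R 0 = 0"
    and mono: "\<And>x y. 0 \<le> x \<Longrightarrow> x \<le> y \<Longrightarrow> R x \<le> R y"
    and strict: "\<And>x y. 0 \<le> x \<Longrightarrow> x < y \<Longrightarrow> 0 < R x \<Longrightarrow> R x < R y"
    and unbdd: "\<And>c. \<exists>x\<ge>0. c \<le> R x"
  obtains w where "\<And>s. 0 < s \<Longrightarrow> 0 < w s \<and> R (w s) = s"
    and "\<And>s t. 0 < s \<Longrightarrow> s < t \<Longrightarrow> w s < w t"
    and "continuous_on {0<..} w" and "filterlim w at_top at_top"
proof -
  have "\<exists>x>0. R x = s" if s: "0 < s" for s
  proof -
    obtain b where b: "0 \<le> b" "s \<le> R b"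
      using unbdd by blast
    obtain x where "0 \<le> x" "R x = s"
      using IVT'[of R 0 s b] b s zero continuous_on_subset[OF cont, of "{0..b}"] by auto
    then show ?thesis
      using zero s by (intro exI[of _ x]) (auto simp: less_le)
  qed
  then obtain w where w: "\<And>s. 0 < s \<Longrightarrow> 0 < w s" "\<And>s. 0 < s \<Longrightarrow> R (w s) = s"
    by metis
  have w_mono: "w s < w t" if "0 < s" "s < t" for s t
  proof (rule ccontr)
    assume "\<not> w s < w t"
    then have "w t \<le> w s" by simp
    then show False
      using mono[of "w t" "w s"] w[of s] w[of t] that by auto
  qed
  have inv: "w (R x) = x" if "0 \<le> x" "0 < R x" for x
    using strict[of x "w (R x)"] strict[of "w (R x)" x] w[of "R x"] that
    by (cases x "w (R x)" rule: linorder_cases) auto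
  have "x \<in> w ` {0<..}" if "0 < x" "0 < R x" for x
    using inv[of x] that by (intro image_eqI[of _ _ "R x"]) auto
  then have "w ` {0<..} = {0<..} \<inter> R -` {0<..}"
    using w by auto
  moreover have "open ({0<..} \<inter> R -` {0<..})"
    by (intro continuous_open_preimage continuous_on_subset[OF cont]) auto
  \<comment> \<open>The image of \<open>w\<close> is the open set of positive points where
    \<open>R\<close> is positive, and an increasing function with open image has no jumps.\<close>
  ultimately have "continuous_on {0<..} w"
    using w_mono by (intro continuous_onI_mono) (auto simp: le_less)
  moreover have "filterlim w at_top at_top"
    unfolding filterlim_at_top
  proof
    fix Z
    have "\<forall>\<^sub>F s in at_top. max 0 (R (max 0 Z)) < s"
      by (rule eventually_gt_at_top)
    then show "\<forall>\<^sub>F s in at_top. Z \<le> w s"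
    proof eventually_elim
      case (elim s)
      then show ?case
        using mono[of "w s" "max 0 Z"] w[of s] by (cases "Z \<le> w s") auto
    qed
  qed
  ultimately show ?thesis
    using that w w_mono by blast
qed

section \<open>Mean rates over a random gain\<close>

text \<open>In a first-countable space continuity can be tested along sequences, and for these
  dominated convergence applies.\<close>

lemma continuous_on_integral_dominated:
  fixes f :: "'b::first_countable_topology \<Rightarrow> 'a \<Rightarrow> real"
  assumes "\<And>x. x \<in> A \<Longrightarrow> f x \<in> borel_measurable M"
    and "\<And>\<omega>. \<omega> \<in> space M \<Longrightarrow> continuous_on A (\<lambda>x. f x \<omega>)"
    and "integrable M g"
    and "\<And>x. x \<in> A \<Longrightarrow> AE \<omega> in M. norm (f x \<omega>) \<le> g \<omega>"
  shows "continuous_on A (\<lambda>x. \<integral>\<omega>. f x \<omega> \<partial>M)"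
  unfolding continuous_on_def
proof
  fix a assume a: "a \<in> A"
  show "((\<lambda>x. \<integral>\<omega>. f x \<omega> \<partial>M) \<longlongrightarrow> (\<integral>\<omega>. f a \<omega> \<partial>M)) (at a within A)"
    unfolding tendsto_at_iff_sequentially comp_def
  proof safe
    fix X assume X: "\<forall>i. X i \<in> A - {a}" "X \<longlonglongrightarrow> a"
    have "(\<lambda>i. f (X i) \<omega>) \<longlonglongrightarrow> f a \<omega>" if "\<omega> \<in> space M" for \<omega>
      using continuous_on_tendsto_compose[OF assms(2)[OF that] X(2) a] X(1) by auto
    then show "(\<lambda>i. \<integral>\<omega>. f (X i) \<omega> \<partial>M) \<longlonglongrightarrow> (\<integral>\<omega>. f a \<omega> \<partial>M)"
      using assms X a by (intro integral_dominated_convergence[where w = g]) auto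
  qed
qed

locale fading = prob_space M for M :: "'a measure" +
  fixes G :: "'a \<Rightarrow> real"
  assumes random_gain: "random_gain M G"
begin

lemma G_nonneg: "\<omega> \<in> space M \<Longrightarrow> 0 \<le> G \<omega>"
  using random_gain by (auto simp: random_gain_def)

lemma G_measurable [measurable]: "G \<in> borel_measurable M"
  using random_gain by (auto simp: random_gain_def distributed_def)

text \<open>The gain has a density, so the single point 0 carries no mass.\<close>

lemma G_pos: "AE \<omega> in M. 0 < G \<omega>"
proof -
  obtain f where f: "distr M lborel G = density lborel f" "f \<in> borel_measurable lborel"
    using random_gain by (auto simp: random_gain_def distributed_def)
  have "AE x in density lborel f. x \<noteq> (0::real)"
    using f AE_lborel_singleton[of "0::real"] by (auto simp: AE_density elim: eventually_mono)
  then have "AE \<omega> in M. G \<omega> \<noteq> 0"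
    unfolding f(1)[symmetric] by (subst (asm) AE_distr_iff) auto
  with AE_space show ?thesis
    by eventually_elim (use G_nonneg in \<open>force simp: less_le\<close>)
qed

lemma integrable_log:
  assumes "0 \<le> p"
  shows "integrable M (\<lambda>\<omega>. log 2 (1 + G \<omega> * p))"
proof (rule integrableI_nonneg)
  show "AE \<omega> in M. 0 \<le> log 2 (1 + G \<omega> * p)"
    using AE_space
    by eventually_elim (subst zero_le_log_cancel_iff, auto simp: add_pos_nonneg G_nonneg assms)
  show "(\<integral>\<^sup>+ \<omega>. ennreal (log 2 (1 + G \<omega> * p)) \<partial>M) < \<infinity>"
    using random_gain assms by (auto simp: random_gain_def mean_rate_def)
qed auto

text \<open>Otherwise \<open>G\<close> would almost surely lie below every
  \<open>1 / (n + 1)\<close>, against \<open>G_pos\<close>. The event found here later forces the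
  mean rate to be unbounded.\<close>

lemma gain_bounded_below: "\<exists>c>0. 0 < prob {\<omega> \<in> space M. c \<le> G \<omega>}"
proof (rule ccontr)
  assume *: "\<not> ?thesis"
  have "AE \<omega> in M. G \<omega> < 1 / real (Suc n)" for n
  proof -
    have "prob {\<omega> \<in> space M. 1 / real (Suc n) \<le> G \<omega>} = 0"
      using * by (metis measure_nonneg less_le of_nat_0_less_iff zero_less_Suc zero_less_divide_1_iff)
    then have "AE \<omega> in M. \<omega> \<notin> {\<omega> \<in> space M. 1 / real (Suc n) \<le> G \<omega>}"
      by (subst (asm) prob_eq_0) auto
    with AE_space show ?thesis
      by eventually_elim auto
  qed
  then have "AE \<omega> in M. \<forall>n. G \<omega> < 1 / real (Suc n)"
    by (simp add: AE_all_countable)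
  with G_pos have "AE \<omega> in M. False"
  proof eventually_elim
    case (elim \<omega>)
    then show ?case
      using reals_Archimedean[of "G \<omega>"] by (force simp: inverse_eq_divide dest: order_less_asym)
  qed
  then show False
    by simp
qed

end

text \<open>Both random channels are governed by a mean rate \<open>E[U(G x)]\<close>: with transmission power \<open>x\<close>
  and \<open>U(y) = log 2 (1 + y)\<close> if only the distribution is known, with water level \<open>x\<close> and
  \<open>U(y) = log 2 (max 1 y)\<close> if the gain is known.\<close>

locale fading_rate = fading +
  fixes U :: "real \<Rightarrow> real"
  assumes U_continuous: "continuous_on {0..} U"
    and U_lower: "0 \<le> y \<Longrightarrow> log 2 (max 1 y) \<le> U y"
    and U_upper: "0 \<le> y \<Longrightarrow> U y \<le> log 2 (1 + y)"
    and U_mono: "0 \<le> y \<Longrightarrow> y \<le> z \<Longrightarrow> U y \<le> U z"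
    and U_strict: "0 \<le> y \<Longrightarrow> y < z \<Longrightarrow> 0 < U y \<Longrightarrow> U y < U z"
begin

definition rate :: "real \<Rightarrow> real" where
  "rate x = (\<integral>\<omega>. U (G \<omega> * x) \<partial>M)"

lemma U_nonneg: "0 \<le> y \<Longrightarrow> 0 \<le> U y"
  using U_lower[of y] by (rule order_trans[rotated]) auto

lemma U_measurable:
  assumes "0 \<le> x"
  shows "(\<lambda>\<omega>. U (G \<omega> * x)) \<in> borel_measurable M"
proof -
  \<comment> \<open>\<open>U\<close> is controlled only on the nonnegative reals; composing with
    \<open>max 0\<close> extends it to a continuous function on the whole line.\<close>
  have "continuous_on UNIV (\<lambda>y. U (max 0 y))"
    by (rule continuous_on_compose2[OF U_continuous]) (auto intro!: continuous_intros)
  then have "(\<lambda>y. U (max 0 y)) \<in> borel_measurable borel"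
    by (rule borel_measurable_continuous_onI)
  then have "(\<lambda>\<omega>. U (max 0 (G \<omega> * x))) \<in> borel_measurable M"
    by measurable
  also have "?this \<longleftrightarrow> ?thesis"
    using assms G_nonneg by (intro measurable_cong) auto
  finally show ?thesis .
qed

lemma U_integrable:
  assumes "0 \<le> x"
  shows "integrable M (\<lambda>\<omega>. U (G \<omega> * x))"
proof (rule Bochner_Integration.integrable_bound[OF integrable_log[OF assms] U_measurable[OF assms]])
  show "AE \<omega> in M. norm (U (G \<omega> * x)) \<le> norm (log 2 (1 + G \<omega> * x))"
    using AE_space
  proof eventually_elim
    case (elim \<omega>)
    then show ?case
      using U_upper[of "G \<omega> * x"] U_nonneg[of "G \<omega> * x"] G_nonneg assms by auto
  qed
qed

lemma nn_integral_U:
  assumes "0 \<le> x"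
  shows "(\<integral>\<^sup>+\<omega>. ennreal (U (G \<omega> * x)) \<partial>M) = ennreal (rate x)"
  unfolding rate_def using U_integrable[OF assms]
proof (rule nn_integral_eq_integral)
  show "AE \<omega> in M. 0 \<le> U (G \<omega> * x)"
    using AE_space by eventually_elim (use G_nonneg U_nonneg assms in auto)
qed

lemma rate_zero: "rate 0 = 0"
  using U_lower[of 0] U_upper[of 0] by (simp add: rate_def)

lemma rate_mono:
  assumes "0 \<le> x" "x \<le> y"
  shows "rate x \<le> rate y"
  unfolding rate_def using assms G_nonneg
  by (intro integral_mono U_integrable U_mono mult_left_mono mult_nonneg_nonneg) auto

text \<open>If the two means agree, the nonnegative difference of the integrands vanishes almost
  everywhere. As \<open>G\<close> is almost surely positive, \<open>U_strict\<close> then forces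
  \<open>U (G \<omega> * x) = 0\<close> almost everywhere, so \<open>rate x\<close> would be
  0.\<close>

lemma rate_strict:
  assumes "0 \<le> x" "x < y" "0 < rate x"
  shows "rate x < rate y"
proof (rule ccontr)
  let ?D = "\<lambda>\<omega>. U (G \<omega> * y) - U (G \<omega> * x)"
  assume "\<not> rate x < rate y"
  then have "rate y - rate x = 0"
    using rate_mono[of x y] assms by simp
  then have "(\<integral>\<omega>. ?D \<omega> \<partial>M) = 0"
    using assms by (simp add: rate_def U_integrable)
  moreover have "AE \<omega> in M. 0 \<le> ?D \<omega>"
    using AE_space
    by eventually_elim (use G_nonneg assms in \<open>auto intro!: U_mono mult_left_mono\<close>)
  moreover have "integrable M ?D"
    using assms by (auto intro!: U_integrable)
  ultimately have "AE \<omega> in M. ?D \<omega> = 0"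
    using integral_nonneg_eq_0_iff_AE by blast
  then have "AE \<omega> in M. U (G \<omega> * x) = 0"
    using G_pos
  proof eventually_elim
    case (elim \<omega>)
    then show ?case
      using U_strict[of "G \<omega> * x" "G \<omega> * y"] U_nonneg[of "G \<omega> * x"] assms by fastforce
  qed
  then have "rate x = (\<integral>\<omega>. 0 \<partial>M)"
    unfolding rate_def using assms U_measurable by (intro integral_cong_AE) auto
  then show False
    using assms by simp
qed

text \<open>On a bounded interval the integrand at the right endpoint dominates all others.
  Continuity is local, so bounded intervals suffice.\<close>

lemma rate_continuous: "continuous_on {0..} rate"
proof -
  have bounded: "continuous_on {0..b} rate" for b
    unfolding rate_def
  proof (cases "0 \<le> b", rule continuous_on_integral_dominated)
    assume b: "0 \<le> b"
    show "integrable M (\<lambda>\<omega>. U (G \<omega> * b))"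
      using b by (rule U_integrable)
    fix x assume x: "x \<in> {0..b}"
    show "AE \<omega> in M. norm (U (G \<omega> * x)) \<le> U (G \<omega> * b)"
      using AE_space
    proof eventually_elim
      case (elim \<omega>)
      then show ?case
        using U_nonneg[of "G \<omega> * x"] U_mono[of "G \<omega> * x" "G \<omega> * b"] G_nonneg x
        by (auto intro!: mult_left_mono)
    qed
  qed (auto intro!: U_measurable continuous_on_compose2[OF U_continuous] continuous_intros
      mult_nonneg_nonneg G_nonneg)
  show ?thesis
    unfolding continuous_on_eq_continuous_within
  proof
    fix x :: real assume x: "x \<in> {0..}"
    have "at x within {0..x+1} = at x within {0..}"
      by (rule at_within_nhd[of _ "{..<x+1}"]) auto
    then show "continuous (at x within {0..}) rate"
      using bounded[of "x+1"] x by (force simp: continuous_on_eq_continuous_within continuous_within)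
  qed
qed

text \<open>On the event that the gain is at least \<open>c\<close>, which has positive probability,
  \<open>U_lower\<close> bounds the integrand below by a logarithm of \<open>x\<close>.\<close>

lemma rate_unbounded: "\<exists>x\<ge>0. C \<le> rate x"
proof -
  obtain c where c: "0 < c" "0 < prob {\<omega> \<in> space M. c \<le> G \<omega>}" (is "0 < prob ?A")
    using gain_bounded_below by blast
  have lower: "prob ?A * log 2 (max 1 (c * x)) \<le> rate x" if x: "0 \<le> x" for x
  proof -
    have "(\<integral>\<omega>. indicator ?A \<omega> * log 2 (max 1 (c * x)) \<partial>M) \<le> rate x"
      unfolding rate_def
    proof (rule integral_mono)
      fix \<omega> assume \<omega>: "\<omega> \<in> space M"
      have "log 2 (max 1 (c * x)) \<le> U (G \<omega> * x)" if "c \<le> G \<omega>"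
      proof -
        have "c * x \<le> G \<omega> * x"
          using that x by (rule mult_right_mono)
        then have "log 2 (max 1 (c * x)) \<le> log 2 (max 1 (G \<omega> * x))"
          by (subst log_le_cancel_iff) auto
        also have "\<dots> \<le> U (G \<omega> * x)"
          using \<omega> G_nonneg x by (intro U_lower) auto
        finally show ?thesis .
      qed
      then show "indicator ?A \<omega> * log 2 (max 1 (c * x)) \<le> U (G \<omega> * x)"
        using \<omega> G_nonneg x by (auto simp: indicator_def intro!: U_nonneg)
    qed (use x in \<open>auto intro!: U_integrable simp: emeasure_eq_measure\<close>)
    then show ?thesis
      by simp
  qed
  \<comment> \<open>Chosen so that the logarithm of \<open>c * x\<close> is
    \<open>C / prob ?A\<close>; the \<open>max 0\<close> keeps \<open>c * x\<close> at least
    1.\<close>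
  define x where "x = 2 powr max 0 (C / prob ?A) / c"
  have "c * x = 2 powr max 0 (C / prob ?A)"
    using c by (simp add: x_def)
  moreover have "1 \<le> 2 powr max 0 (C / prob ?A)"
    by (intro ge_one_powr_ge_zero) auto
  ultimately have "log 2 (max 1 (c * x)) = max 0 (C / prob ?A)"
    by (simp add: max_absorb2)
  then have "C \<le> prob ?A * log 2 (max 1 (c * x))"
    using c by (simp add: max_def field_simps)
  moreover have "0 \<le> x"
    using c by (simp add: x_def)
  ultimately show ?thesis
    using lower[of x] by (intro exI[of _ x]) auto
qed

lemmas inverse_rate =
  rate_inverse[OF rate_continuous rate_zero rate_mono rate_strict rate_unbounded]

end

section \<open>The three channels\<close>

text \<open>The tangent inequality is \<open>1 + y \<le> exp y\<close> at
  \<open>y = (t - s) * ln 2\<close>, scaled by \<open>2 powr s / G\<close>.\<close>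

lemma strict_subgradient_static:
  assumes "0 < G"
  shows "strict_subgradient (rho (Static G)) (\<lambda>s. 2 powr s * ln 2 / G)"
proof -
  have rho: "rho (Static G) s = (2 powr s - 1) / G" if "0 \<le> s" for s
    unfolding rho.simps
  proof (rule Least_equality)
    show "0 \<le> (2 powr s - 1) / G \<and> s \<le> log 2 (1 + G * ((2 powr s - 1) / G))"
      using assms that by (auto simp: ge_one_powr_ge_zero)
    fix p assume p: "0 \<le> p \<and> s \<le> log 2 (1 + G * p)"
    then have "0 < 1 + G * p"
      using assms by (simp add: add_pos_nonneg)
    then have "2 powr s \<le> 1 + G * p"
      using p by (simp add: le_log_iff)
    then show "(2 powr s - 1) / G \<le> p"
      using assms by (simp add: field_simps)
  qed
  show ?thesis
  proof
    show "rho (Static G) 0 = 0"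
      by (simp add: rho del: rho.simps)
    show "0 \<le> rho (Static G) s" if "0 \<le> s" for s
      using that assms by (auto simp: rho ge_one_powr_ge_zero simp del: rho.simps)
    show "rho (Static G) s + 2 powr s * ln 2 / G * (t - s) \<le> rho (Static G) t"
      if "0 < s" "0 \<le> t" for s t
    proof -
      have "1 + (t - s) * ln 2 \<le> exp ((t - s) * ln 2)"
        by (rule exp_ge_add_one_self)
      also have "\<dots> = 2 powr t / 2 powr s"
        by (simp add: powr_def exp_diff[symmetric] algebra_simps)
      finally have "2 powr s + 2 powr s * ln 2 * (t - s) \<le> 2 powr t"
        by (simp add: field_simps)
      then have "(2 powr s - 1 + 2 powr s * ln 2 * (t - s)) / G \<le> (2 powr t - 1) / G"
        using assms by (intro divide_right_mono) auto
      then show ?thesis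
        using that by (simp add: rho add_divide_distrib del: rho.simps)
    qed
    show "2 powr s * ln 2 / G < 2 powr t * ln 2 / G" if "0 < s" "s < t" for s t :: real
      using that assms by (intro divide_strict_right_mono mult_strict_right_mono) auto
    show "continuous_on {0<..} (\<lambda>s. 2 powr s * ln 2 / G)"
      using assms by (intro continuous_intros) auto
    show "filterlim (\<lambda>s. 2 powr s * ln 2 / G) at_top at_top"
      using assms by real_asymp
  qed
qed

text \<open>\<open>rho\<close> inverts the concave function \<open>rate\<close>. A supergradient
  \<open>slope\<close> of \<open>rate\<close>, obtained by differentiating under the integral,
  therefore becomes the subgradient \<open>1 / slope (w s)\<close> of \<open>rho\<close>.\<close>

lemma (in fading) strict_subgradient_distribution:
  "\<exists>d. strict_subgradient (rho (Fast_Distribution M G)) d"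
proof -
  interpret fading_rate M G "\<lambda>y. log 2 (1 + y)"
    by unfold_locales (auto intro!: continuous_intros)
  obtain w where w: "\<And>s. 0 < s \<Longrightarrow> 0 < w s \<and> rate (w s) = s"
    and w_mono: "\<And>s t. 0 < s \<Longrightarrow> s < t \<Longrightarrow> w s < w t"
    and w_cont: "continuous_on {0<..} w" and w_lim: "filterlim w at_top at_top"
    using inverse_rate by blast
  define D where "D p \<omega> = G \<omega> / ((1 + G \<omega> * p) * ln 2)" for p \<omega>
  define slope where "slope p = (\<integral>\<omega>. D p \<omega> \<partial>M)" for p
  have D_measurable [measurable]: "D p \<in> borel_measurable M" for p
    unfolding D_def by measurable
  have pos: "0 < 1 + G \<omega> * p" if "\<omega> \<in> space M" "0 \<le> p" for \<omega> p
    using G_nonneg that by (intro add_pos_nonneg) auto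
  \<comment> \<open>The bound is uniform in the gain, so it yields integrability even if
    \<open>G\<close> has infinite mean.\<close>
  have D_bound: "norm (D p \<omega>) \<le> 1 / (a * ln 2)" if "\<omega> \<in> space M" "0 < a" "a \<le> p" for a p \<omega>
  proof -
    have "a * G \<omega> \<le> p * G \<omega>"
      using that G_nonneg by (intro mult_right_mono) auto
    then have "G \<omega> / (1 + G \<omega> * p) \<le> 1 / a"
      using pos[of \<omega> p] that by (simp add: field_simps)
    then have "G \<omega> / (1 + G \<omega> * p) / ln 2 \<le> 1 / a / ln 2"
      by (rule divide_right_mono) auto
    then show ?thesis
      using pos[of \<omega> p] G_nonneg that by (simp add: D_def)
  qed
  have D_integrable: "integrable M (D p)" if "0 < p" for p
    using D_bound[of _ p p] that
    by (intro integrable_const_bound[of _ "1 / (p * ln 2)"] AE_I2) auto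
  have slope_strict: "slope q < slope p" if "0 < p" "p < q" for p q
    unfolding slope_def
  proof (rule integral_less_AE_space)
    show "AE \<omega> in M. D q \<omega> < D p \<omega>"
      using G_pos unfolding D_def
      by eventually_elim
        (use that in \<open>auto intro!: divide_strict_left_mono mult_strict_right_mono mult_pos_pos add_pos_pos\<close>)
  qed (use that in \<open>auto intro!: D_integrable simp: emeasure_space_1\<close>)
  have slope_pos: "0 < slope p" if "0 < p" for p
  proof -
    have "0 \<le> slope (p + 1)"
      unfolding slope_def using pos[of _ "p + 1"] G_nonneg that
      by (intro integral_nonneg_AE AE_I2) (auto simp: D_def less_imp_le)
    then show ?thesis
      using slope_strict[of p "p + 1"] that by simp
  qed
  have slope_le: "slope p \<le> 1 / (p * ln 2)" if "0 < p" for p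
  proof -
    have "slope p \<le> (\<integral>\<omega>. 1 / (p * ln 2) \<partial>M)"
      unfolding slope_def using D_bound[of _ p p] that
      by (intro integral_mono D_integrable) force+
    then show ?thesis
      by (simp add: prob_space)
  qed
  \<comment> \<open>The dominating constant \<open>1 / (a * ln 2)\<close> blows up as
    \<open>a\<close> tends to 0, so continuity is first shown away from 0.\<close>
  have "continuous_on {a<..} slope" if a: "0 < a" for a
    unfolding slope_def
  proof (rule continuous_on_integral_dominated)
    show "continuous_on {a<..} (\<lambda>p. D p \<omega>)" if "\<omega> \<in> space M" for \<omega>
      unfolding D_def using pos[OF that] a
      by (intro continuous_intros) (auto simp: less_imp_neq[symmetric])
    show "AE \<omega> in M. norm (D p \<omega>) \<le> 1 / (a * ln 2)" if "p \<in> {a<..}" for p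
      using that a by (intro AE_I2 D_bound) auto
  qed auto
  then have "isCont slope p" if "0 < p" for p
    using that continuous_on_eq_continuous_at[of "{p/2<..}" slope] by auto
  then have slope_cont: "continuous_on {0<..} slope"
    by (simp add: continuous_at_imp_continuous_on)
  have tangent: "rate q \<le> rate p + slope p * (q - p)" if "0 < p" "0 \<le> q" for p q
  proof -
    have "rate q \<le> (\<integral>\<omega>. log 2 (1 + G \<omega> * p) + D p \<omega> * (q - p) \<partial>M)"
      unfolding rate_def
    proof (rule integral_mono)
      fix \<omega> assume \<omega>: "\<omega> \<in> space M"
      have "ln (1 + G \<omega> * q) - ln (1 + G \<omega> * p) \<le> (1 + G \<omega> * q - (1 + G \<omega> * p)) / (1 + G \<omega> * p)"
        using pos \<omega> that by (intro ln_diff_le) auto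
      then have "(ln (1 + G \<omega> * q) - ln (1 + G \<omega> * p)) / ln 2
          \<le> (1 + G \<omega> * q - (1 + G \<omega> * p)) / (1 + G \<omega> * p) / ln 2"
        by (rule divide_right_mono) auto
      also have "\<dots> = D p \<omega> * (q - p)"
        by (simp add: D_def algebra_simps)
      finally show "log 2 (1 + G \<omega> * q) \<le> log 2 (1 + G \<omega> * p) + D p \<omega> * (q - p)"
        by (simp add: log_def diff_divide_distrib)
    qed (use that in \<open>auto intro!: integrable_log D_integrable\<close>)
    also have "\<dots> = rate p + slope p * (q - p)"
      using that by (simp add: rate_def slope_def integrable_log D_integrable)
    finally show ?thesis .
  qed
  define r where "r = rho (Fast_Distribution M G)"
  have mean_rate: "mean_rate M G (\<lambda>_. p) = ennreal (rate p)" if "0 \<le> p" for p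
    using nn_integral_U[OF that] by (simp add: mean_rate_def)
  \<comment> \<open>Rate 0 is treated separately since \<open>w\<close> is specified only for
    positive rates.\<close>
  have rho_zero: "r 0 = 0"
    unfolding r_def by (auto intro!: Least_equality)
  have rho: "r s = w s" if s: "0 < s" for s
    unfolding r_def rho.simps
  proof (rule Least_equality)
    show "0 \<le> w s \<and> ennreal s \<le> mean_rate M G (\<lambda>_. w s)"
      using w[OF s] by (simp add: mean_rate)
    fix p assume p: "0 \<le> p \<and> ennreal s \<le> mean_rate M G (\<lambda>_. p)"
    then have "s \<le> rate p"
      using s by (auto simp: mean_rate ennreal_le_iff2)
    then show "w s \<le> p"
      using rate_strict[of p "w s"] w[OF s] p s by force
  qed
  have rate_rho: "0 \<le> r t \<and> rate (r t) = t"
    if "0 \<le> t" for t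
  proof (cases "t = 0")
    case True
    then show ?thesis
      by (simp add: rho_zero rate_zero)
  next
    case False
    then show ?thesis
      using that w[of t] by (simp add: rho less_imp_le)
  qed
  have "strict_subgradient (r) (\<lambda>s. 1 / slope (w s))"
  proof
    show "r 0 = 0"
      by (rule rho_zero)
    show "0 \<le> r s" if "0 \<le> s" for s
      using rate_rho[OF that] by blast
    show "r s + 1 / slope (w s) * (t - s) \<le> r t"
      if "0 < s" "0 \<le> t" for s t
    proof -
      have "t \<le> s + slope (w s) * (r t - w s)"
        using tangent[of "w s" "r t"] rate_rho[of t] w[of s] that by simp
      then have "(t - s) / slope (w s) \<le> r t - w s"
        using slope_pos[of "w s"] w[of s] that by (simp add: pos_divide_le_eq mult.commute)
      then show ?thesis
        using that by (simp add: rho)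
    qed
    show "1 / slope (w s) < 1 / slope (w t)" if "0 < s" "s < t" for s t
      using slope_strict[of "w s" "w t"] slope_pos[of "w t"] w[of s] w[of t] w_mono that
      by (intro divide_strict_left_mono mult_pos_pos) (auto intro: slope_pos)
    show "continuous_on {0<..} (\<lambda>s. 1 / slope (w s))"
      using w slope_pos
      by (intro continuous_intros continuous_on_compose2[OF slope_cont] w_cont)
        (force simp: less_imp_neq[symmetric])+
    \<comment> \<open>\<open>slope_le\<close> makes the reciprocal slope at least
      \<open>ln 2 * w s\<close>.\<close>
    show "filterlim (\<lambda>s. 1 / slope (w s)) at_top at_top"
    proof (rule filterlim_at_top_mono)
      show "filterlim (\<lambda>s. ln 2 * w s) at_top at_top"
        by (intro filterlim_tendsto_pos_mult_at_top[OF tendsto_const] w_lim) auto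
      show "\<forall>\<^sub>F s in at_top. ln 2 * w s \<le> 1 / slope (w s)"
        using eventually_gt_at_top[of 0]
      proof eventually_elim
        case (elim s)
        then show ?case
          using slope_le[of "w s"] slope_pos[of "w s"] w[of s] by (simp add: field_simps)
      qed
    qed
  qed
  then show ?thesis
    unfolding r_def by blast
qed

text \<open>Water filling minimises the Lagrangian \<open>p - x ln (1 + g p)\<close>, with multiplier the water
  level \<open>x\<close>, separately for every gain \<open>g\<close>.\<close>

lemma water_filling_optimal:
  fixes g p x :: real
  assumes "0 \<le> g" "0 \<le> p" "0 < x"
  shows "max 0 (x * g - 1) / g + x * ln (1 + g * p) \<le> p + x * ln (max 1 (g * x))"
proof (cases "g * x \<le> 1")
  case True
  have "x * ln (1 + g * p) \<le> x * (g * p)"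
    using assms by (intro mult_left_mono ln_add_one_self_le_self) auto
  also have "\<dots> = (g * x) * p"
    by simp
  also have "\<dots> \<le> 1 * p"
    using True assms by (intro mult_right_mono) auto
  finally show ?thesis
    using True by (simp add: mult.commute max_def)
next
  case False
  then have g: "0 < g"
    using assms by (cases "g = 0") auto
  \<comment> \<open>The tangent to \<open>ln\<close> is taken at \<open>g * x\<close>, the value of
    \<open>1 + g * p\<close> at the water-filling power.\<close>
  have "ln (1 + g * p) - ln (g * x) \<le> (1 + g * p - g * x) / (g * x)"
    using g assms by (intro ln_diff_le) (auto intro: add_pos_nonneg)
  then have "x * (ln (1 + g * p) - ln (g * x)) \<le> x * ((1 + g * p - g * x) / (g * x))"
    using assms by (intro mult_left_mono) auto
  also have "\<dots> = p - (x * g - 1) / g"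
    using g assms by (simp add: field_simps)
  finally show ?thesis
    using False by (simp add: algebra_simps max_def)
qed

text \<open>Lagrangian duality does all the work: the inequality \<open>lagrangian\<close> gives
  optimality of water filling when \<open>p\<close> attains rate \<open>s\<close>, and the
  subgradient inequality when \<open>p\<close> is optimal for another rate \<open>t\<close>.\<close>

lemma (in fading) strict_subgradient_state:
  "\<exists>d. strict_subgradient (rho (Fast_State M G)) d"
proof -
  interpret fading_rate M G "\<lambda>y. log 2 (max 1 y)"
  proof
    show "log 2 (max 1 y) < log 2 (max 1 z)" if "0 \<le> y" "y < z" "0 < log 2 (max 1 y)" for y z :: real
    proof -
      have "1 < y"
        using that(3) by (cases "1 < y") (auto simp: max_def split: if_splits)
      then show ?thesis
        using that by (simp add: max_def)
    qed
  qed (auto intro!: continuous_intros)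
  obtain w where w: "\<And>s. 0 < s \<Longrightarrow> 0 < w s \<and> rate (w s) = s"
    and w_mono: "\<And>s t. 0 < s \<Longrightarrow> s < t \<Longrightarrow> w s < w t"
    and w_cont: "continuous_on {0<..} w" and w_lim: "filterlim w at_top at_top"
    using inverse_rate by blast
  define cost where "cost p = (\<integral>\<^sup>+ \<omega>. ennreal (p (G \<omega>)) \<partial>M)" for p :: "real \<Rightarrow> real"
  \<comment> \<open>The water-filling power \<open>x - 1 / g\<close>, truncated at 0. Division by
    zero gives 0, so no power is spent at gain 0.\<close>
  define fill where "fill x g = max 0 (x * g - 1) / g" for x g :: real
  have fill_allocation: "power_allocation (fill x)" for x
    unfolding power_allocation_def
  proof (intro conjI measurable_restrict_space1)
    show "fill x \<in> borel_measurable borel"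
      unfolding fill_def by measurable
  qed (auto simp: fill_def)
  have fill_measurable [measurable]: "fill x \<in> borel_measurable borel" for x
    unfolding fill_def by measurable
  have rate_fill: "mean_rate M G (fill x) = ennreal (rate x)" if x: "0 \<le> x" for x
    unfolding mean_rate_def nn_integral_U[OF x, symmetric]
  proof (rule nn_integral_cong)
    fix \<omega> assume "\<omega> \<in> space M"
    then have "1 + G \<omega> * fill x (G \<omega>) = max 1 (G \<omega> * x)"
      using G_nonneg[of \<omega>] by (cases "G \<omega> = 0") (auto simp: fill_def max_def mult.commute)
    then show "ennreal (log 2 (1 + G \<omega> * fill x (G \<omega>))) = ennreal (log 2 (max 1 (G \<omega> * x)))"
      by simp
  qed
  have cost_finite: "cost (fill x) < \<infinity>" if x: "0 \<le> x" for x
  proof -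
    have "cost (fill x) \<le> (\<integral>\<^sup>+ \<omega>. ennreal x \<partial>M)"
      unfolding cost_def
    proof (intro nn_integral_mono ennreal_leI)
      fix \<omega> assume "\<omega> \<in> space M"
      then show "fill x (G \<omega>) \<le> x"
        using G_nonneg[of \<omega>] x by (cases "G \<omega> = 0") (auto simp: fill_def field_simps max_def)
    qed
    also have "\<dots> < \<infinity>"
      by (simp add: emeasure_space_1)
    finally show ?thesis .
  qed
  \<comment> \<open>The factor \<open>ln 2\<close> turns \<open>log 2\<close> into the
    \<open>ln\<close> of the pointwise inequality. The statement lives in \<open>ennreal\<close>
    because \<open>p\<close> may have infinite cost or rate.\<close>
  have lagrangian: "cost (fill x) + ennreal (x * ln 2) * mean_rate M G p
      \<le> cost p + ennreal (x * ln 2) * ennreal (rate x)"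
    if x: "0 < x" and p: "power_allocation p" for x p
  proof -
    \<comment> \<open>An allocation is measurable only on the nonnegative reals, so \<open>G\<close>
      is regarded as a map into that subspace.\<close>
    have "G \<in> measurable M (restrict_space borel {0..})"
      using G_nonneg by (intro measurable_restrict_space2) auto
    then have [measurable]: "(\<lambda>\<omega>. p (G \<omega>)) \<in> borel_measurable M"
      using p unfolding power_allocation_def by (auto intro: measurable_compose)
    have p_nonneg: "0 \<le> p (G \<omega>)" if "\<omega> \<in> space M" for \<omega>
      using p G_nonneg[OF that] by (auto simp: power_allocation_def)
    have "cost (fill x) + ennreal (x * ln 2) * mean_rate M G p
        = (\<integral>\<^sup>+ \<omega>. ennreal (fill x (G \<omega>)) + ennreal (x * ln 2) * ennreal (log 2 (1 + G \<omega> * p (G \<omega>))) \<partial>M)"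
      unfolding cost_def mean_rate_def by (simp add: nn_integral_add nn_integral_cmult)
    also have "\<dots> \<le> (\<integral>\<^sup>+ \<omega>. ennreal (p (G \<omega>)) + ennreal (x * ln 2) * ennreal (log 2 (max 1 (G \<omega> * x))) \<partial>M)"
    proof (rule nn_integral_mono)
      fix \<omega> assume \<omega>: "\<omega> \<in> space M"
      have "1 \<le> 1 + G \<omega> * p (G \<omega>)"
        using G_nonneg[OF \<omega>] p_nonneg[OF \<omega>] by simp
      then have "0 \<le> log 2 (1 + G \<omega> * p (G \<omega>))"
        by (subst zero_le_log_cancel_iff) auto
      moreover have "fill x (G \<omega>) + x * ln 2 * log 2 (1 + G \<omega> * p (G \<omega>))
          \<le> p (G \<omega>) + x * ln 2 * log 2 (max 1 (G \<omega> * x))"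
        using water_filling_optimal[of "G \<omega>" "p (G \<omega>)" x] G_nonneg[OF \<omega>] p_nonneg[OF \<omega>] x
        by (simp add: fill_def log_def)
      moreover have "0 \<le> fill x (G \<omega>)"
        using G_nonneg[OF \<omega>] by (simp add: fill_def)
      ultimately show "ennreal (fill x (G \<omega>)) + ennreal (x * ln 2) * ennreal (log 2 (1 + G \<omega> * p (G \<omega>)))
          \<le> ennreal (p (G \<omega>)) + ennreal (x * ln 2) * ennreal (log 2 (max 1 (G \<omega> * x)))"
        using p_nonneg[OF \<omega>] x
        by (simp add: ennreal_mult[symmetric] ennreal_plus[symmetric] del: ennreal_plus)
    qed
    also have "\<dots> = cost p + ennreal (x * ln 2) * ennreal (rate x)"
      unfolding cost_def using x nn_integral_U[of x] by (simp add: nn_integral_add nn_integral_cmult)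
    finally show ?thesis .
  qed
  define r where "r = rho (Fast_State M G)"
  have least: "(LEAST e. \<exists>p. power_allocation p \<and> ennreal s \<le> mean_rate M G p \<and> e = cost p) = cost (fill (w s))"
    if s: "0 < s" for s
  proof (rule Least_equality)
    show "\<exists>p. power_allocation p \<and> ennreal s \<le> mean_rate M G p \<and> cost (fill (w s)) = cost p"
      using fill_allocation[of "w s"] rate_fill[of "w s"] w[OF s] by (intro exI[of _ "fill (w s)"]) auto
    fix e assume "\<exists>p. power_allocation p \<and> ennreal s \<le> mean_rate M G p \<and> e = cost p"
    then obtain p where p: "power_allocation p" "ennreal s \<le> mean_rate M G p" "e = cost p"
      by blast
    let ?c = "ennreal (w s * ln 2)"
    \<comment> \<open>With water level \<open>w s\<close> the rate terms on both sides become
      \<open>?c * s\<close>, which is finite and may be cancelled in \<open>ennreal\<close>.\<close>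
    have "?c * ennreal s + cost (fill (w s)) \<le> cost (fill (w s)) + ?c * mean_rate M G p"
      using p(2) by (subst add.commute) (intro add_left_mono mult_left_mono, auto)
    also have "\<dots> \<le> cost p + ?c * ennreal (rate (w s))"
      using w[OF s] p(1) by (intro lagrangian) auto
    also have "\<dots> = ?c * ennreal s + e"
      using w[OF s] p(3) by (simp add: add.commute)
    finally show "cost (fill (w s)) \<le> e"
      using s by (auto simp: ennreal_add_left_cancel_le ennreal_mult_eq_top_iff)
  qed
  have rho: "r s = enn2real (cost (fill (w s)))" if "0 < s" for s
    using least[OF that] by (simp add: r_def cost_def)
  have least_zero: "(LEAST e. \<exists>p. power_allocation p \<and> ennreal 0 \<le> mean_rate M G p \<and> e = cost p) = 0"
    by (intro Least_equality exI[of _ "\<lambda>_. 0"]) (auto simp: power_allocation_def cost_def)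
  then have rho_zero: "r 0 = 0"
    by (simp add: r_def cost_def)
  have optimal: "\<exists>p. power_allocation p \<and> ennreal t \<le> mean_rate M G p \<and> cost p = ennreal (r t)"
    if t: "0 \<le> t" for t
  proof (cases "t = 0")
    case True
    show ?thesis
      unfolding True rho_zero
      by (intro exI[of _ "\<lambda>_. 0"]) (auto simp: power_allocation_def cost_def)
  next
    case False
    then have "0 < t"
      using t by simp
    then show ?thesis
      unfolding rho[OF \<open>0 < t\<close>]
      using w[of t] fill_allocation rate_fill[of "w t"] cost_finite[of "w t"]
      by (intro exI[of _ "fill (w t)"]) auto
  qed
  have "strict_subgradient (r) (\<lambda>s. ln 2 * w s)"
  proof
    show "r 0 = 0"
      by (rule rho_zero)
    show nonneg: "0 \<le> r s" for s
      by (simp add: r_def)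
    show "r s + ln 2 * w s * (t - s) \<le> r t"
      if s: "0 < s" and t: "0 \<le> t" for s t
    proof -
      obtain p where p: "power_allocation p" "ennreal t \<le> mean_rate M G p"
        "cost p = ennreal (r t)"
        using optimal[OF t] by blast
      let ?c = "ennreal (w s * ln 2)"
      \<comment> \<open>Here \<open>p\<close> is optimal for \<open>t\<close>, while the multiplier
        is the one belonging to \<open>s\<close>.\<close>
      have "ennreal (r s) + ?c * ennreal t \<le> cost (fill (w s)) + ?c * mean_rate M G p"
        unfolding rho[OF s] using cost_finite[of "w s"] w[OF s] p(2)
        by (intro add_mono mult_left_mono) auto
      also have "\<dots> \<le> ennreal (r t) + ?c * ennreal s"
        using lagrangian[of "w s" p] w[OF s] p by simp
      finally have "r s + w s * ln 2 * t \<le> r t + w s * ln 2 * s"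
        using s t w[OF s] nonneg[of s] nonneg[of t]
        by (simp add: ennreal_mult[symmetric] ennreal_plus[symmetric] del: ennreal_plus)
      then show ?thesis
        by (simp add: algebra_simps)
    qed
    show "continuous_on {0<..} (\<lambda>s. ln 2 * w s)"
      by (intro continuous_intros w_cont)
    show "filterlim (\<lambda>s. ln 2 * w s) at_top at_top"
      by (intro filterlim_tendsto_pos_mult_at_top[OF tendsto_const] w_lim) auto
  qed (use w_mono in auto)
  then show ?thesis
    unfolding r_def by blast
qed

lemma strict_subgradient_channel:
  assumes "valid_channel ch"
  shows "\<exists>d. strict_subgradient (rho ch) d"
proof (cases ch)
  case (Static G)
  then show ?thesis
    using assms strict_subgradient_static by auto
next
  case (Fast_Distribution M G)
  then interpret fading M G
    using assms by (auto simp: fading_def fading_axioms_def random_gain_def)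
  show ?thesis
    unfolding Fast_Distribution by (rule strict_subgradient_distribution)
next
  case (Fast_State M G)
  then interpret fading M G
    using assms by (auto simp: fading_def fading_axioms_def random_gain_def)
  show ?thesis
    unfolding Fast_State by (rule strict_subgradient_state)
qed

section \<open>The optimal operating point\<close>

lemma convex_differentiable_subgradient:
  fixes f :: "real \<Rightarrow> real"
  assumes "convex_on {0..} f" "f differentiable_on {0..}" "0 < x" "0 \<le> y"
  shows "f x + deriv f x * (y - x) \<le> f y" and "(f has_field_derivative deriv f x) (at x)"
proof -
  have "f differentiable at x within {0..}"
    using assms by (auto simp: differentiable_on_def)
  moreover have "at x within {0..} = at x"
    using assms by (intro at_within_interior) (auto simp: interior_real_atLeast)
  ultimately show D: "(f has_field_derivative deriv f x) (at x)"
    by (metis DERIV_deriv_iff_real_differentiable)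
  have "deriv f x * (y - x) \<le> f y - f x"
    using assms has_field_derivative_at_within[OF D]
    by (intro convex_on_imp_above_tangent[of "{0..}"]) (auto simp: interior_real_atLeast)
  then show "f x + deriv f x * (y - x) \<le> f y"
    by simp
qed

lemma convex_differentiable_deriv_mono:
  fixes f :: "real \<Rightarrow> real"
  assumes "convex_on {0..} f" "f differentiable_on {0..}" "0 < x" "x \<le> y"
  shows "deriv f x \<le> deriv f y"
proof (cases "x = y")
  case False
  have "0 \<le> (deriv f y - deriv f x) * (y - x)"
    using convex_differentiable_subgradient(1)[of f x y] convex_differentiable_subgradient(1)[of f y x]
      assms by (simp add: algebra_simps)
  then show ?thesis
    using False assms by (simp add: zero_le_mult_iff)
qed auto

text \<open>For fixed \<open>h\<close> the difference quotient is continuous in its base point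
  \<open>u\<close>, and it bounds \<open>deriv f u\<close> from above if \<open>h > 0\<close> and
  from below if \<open>h < 0\<close>. It suffices to fix an \<open>h\<close> whose quotient at
  \<open>x\<close> is close enough to \<open>deriv f x\<close>.\<close>

lemma convex_differentiable_deriv_continuous:
  fixes f :: "real \<Rightarrow> real"
  assumes f: "convex_on {0..} f" "f differentiable_on {0..}"
  shows "continuous_on {0<..} (deriv f)"
proof -
  note sub = convex_differentiable_subgradient[OF f]
  have cont: "isCont f x" if "0 < x" for x
    using sub(2)[of x] that DERIV_isCont by blast
  have "isCont (deriv f) x" if x: "0 < x" for x
    unfolding isCont_def
  proof (rule order_tendstoI)
    have quot: "((\<lambda>h. (f (x + h) - f x) / h) \<longlongrightarrow> deriv f x) (at 0)"
      using sub(2)[OF x, of 0] by (simp add: DERIV_def)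
    have near: "\<forall>\<^sub>F u in at x. x / 2 < u"
      using x by (intro order_tendstoD(1)[OF tendsto_ident_at]) auto
    {
      fix a assume "deriv f x < a"
      then have "\<forall>\<^sub>F h in at_right 0. (f (x + h) - f x) / h < a"
        using order_tendstoD(2)[OF quot] by (auto simp: eventually_at_split)
      then have "\<forall>\<^sub>F h in at_right 0. (f (x + h) - f x) / h < a \<and> 0 < h"
        using eventually_at_right_less by (rule eventually_conj)
      then obtain h where h: "(f (x + h) - f x) / h < a" "0 < h"
        using eventually_happens'[OF trivial_limit_at_right_real] by fast
      have "((\<lambda>u. (f (u + h) - f u) / h) \<longlongrightarrow> (f (x + h) - f x) / h) (at x)"
        using h x by (intro tendsto_intros isCont_tendsto_compose[OF cont]) auto
      then have "\<forall>\<^sub>F u in at x. (f (u + h) - f u) / h < a"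
        using h by (intro order_tendstoD(2)) auto
      then show "\<forall>\<^sub>F u in at x. deriv f u < a"
        using near
      proof eventually_elim
        case (elim u)
        then have "deriv f u * h \<le> f (u + h) - f u"
          using sub(1)[of u "u + h"] x h by simp
        then show ?case
          using elim h by (meson le_less_trans pos_le_divide_eq)
      qed
    next
      fix a assume "a < deriv f x"
      then have "\<forall>\<^sub>F h in at_left 0. a < (f (x + h) - f x) / h"
        using order_tendstoD(1)[OF quot] by (auto simp: eventually_at_split)
      \<comment> \<open>Together with \<open>x / 2 < u\<close>, the lower bound on \<open>h\<close>
        keeps \<open>u + h\<close> positive.\<close>
      moreover have "\<forall>\<^sub>F h in at_left 0. h < 0 \<and> - x / 2 < h"
        using x by (auto simp: eventually_at_left_field intro!: exI[of _ "- x / 2"])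
      ultimately have "\<forall>\<^sub>F h in at_left 0. a < (f (x + h) - f x) / h \<and> h < 0 \<and> - x / 2 < h"
        by (rule eventually_conj)
      then obtain h where h: "a < (f (x + h) - f x) / h" "h < 0" "- x / 2 < h"
        using eventually_happens'[OF trivial_limit_at_left_real] by fast
      have "((\<lambda>u. (f (u + h) - f u) / h) \<longlongrightarrow> (f (x + h) - f x) / h) (at x)"
        using h x by (intro tendsto_intros isCont_tendsto_compose[OF cont]) auto
      then have "\<forall>\<^sub>F u in at x. a < (f (u + h) - f u) / h"
        using h by (intro order_tendstoD(1)) auto
      then show "\<forall>\<^sub>F u in at x. a < deriv f u"
        using near
      proof eventually_elim
        case (elim u)
        then have "deriv f u * h \<le> f (u + h) - f u"
          using sub(1)[of u "u + h"] x h by simp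
        then show ?case
          using elim h by (meson less_le_trans neg_divide_le_eq)
      qed
    }
  qed
  then show ?thesis
    by (simp add: continuous_at_imp_continuous_on)
qed

text \<open>The convex term contributes a continuous, nondecreasing and nonnegative slope; strict
  growth and unboundedness are inherited from \<open>d\<close>.\<close>

lemma strict_subgradient_add_convex:
  fixes \<phi> :: "real \<Rightarrow> real"
  assumes "strict_subgradient \<rho> d" and "0 < B" "0 \<le> \<kappa>" "0 < c" and "\<phi> 0 = 0"
    and \<phi>: "convex_on {0..} \<phi>" "\<phi> differentiable_on {0..}" and "mono_on {0..} \<phi>"
  shows "strict_subgradient (\<lambda>s. \<kappa> * \<phi> (B * s) + c * \<rho> s)
    (\<lambda>s. \<kappa> * (deriv \<phi> (B * s) * B) + c * d s)"
proof -
  interpret \<rho>: strict_subgradient \<rho> d by fact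
  have \<phi>_nonneg: "0 \<le> \<phi> x" if "0 \<le> x" for x
    using mono_onD[OF \<open>mono_on {0..} \<phi>\<close>, of 0 x] that \<open>\<phi> 0 = 0\<close> by simp
  note sub = convex_differentiable_subgradient(1)[OF \<phi>]
  \<comment> \<open>The tangent at \<open>x\<close> tested at 0 gives
    \<open>\<phi> x \<le> deriv \<phi> x * x\<close>.\<close>
  have deriv_nonneg: "0 \<le> deriv \<phi> x" if "0 < x" for x
  proof -
    have "0 \<le> deriv \<phi> x * x"
      using sub[of x 0] \<phi>_nonneg[of x] that \<open>\<phi> 0 = 0\<close> by simp
    then show ?thesis
      using that by (simp add: zero_le_mult_iff)
  qed
  show ?thesis
  proof
    show "\<kappa> * \<phi> (B * 0) + c * \<rho> 0 = 0"
      using \<open>\<phi> 0 = 0\<close> \<rho>.zero by simp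
    show "0 \<le> \<kappa> * \<phi> (B * s) + c * \<rho> s" if "0 \<le> s" for s
      using that assms \<phi>_nonneg[of "B * s"] \<rho>.nonneg[of s] by simp
    show "\<kappa> * \<phi> (B * s) + c * \<rho> s + (\<kappa> * (deriv \<phi> (B * s) * B) + c * d s) * (t - s)
        \<le> \<kappa> * \<phi> (B * t) + c * \<rho> t" if "0 < s" "0 \<le> t" for s t
    proof -
      have "\<kappa> * (\<phi> (B * s) + deriv \<phi> (B * s) * (B * t - B * s)) \<le> \<kappa> * \<phi> (B * t)"
        using that assms by (intro mult_left_mono sub) auto
      moreover have "c * (\<rho> s + d s * (t - s)) \<le> c * \<rho> t"
        using that assms by (intro mult_left_mono \<rho>.subgradient) auto
      ultimately show ?thesis
        by (simp add: algebra_simps)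
    qed
    show "\<kappa> * (deriv \<phi> (B * s) * B) + c * d s < \<kappa> * (deriv \<phi> (B * t) * B) + c * d t"
      if "0 < s" "s < t" for s t
      using that assms \<rho>.strict[of s t]
      by (intro add_le_less_mono mult_left_mono mult_right_mono mult_strict_left_mono
          convex_differentiable_deriv_mono[OF \<phi>]) auto
    show "continuous_on {0<..} (\<lambda>s. \<kappa> * (deriv \<phi> (B * s) * B) + c * d s)"
      using assms
      by (intro continuous_intros \<rho>.continuous
          continuous_on_compose2[OF convex_differentiable_deriv_continuous[OF \<phi>]]) auto
    show "filterlim (\<lambda>s. \<kappa> * (deriv \<phi> (B * s) * B) + c * d s) at_top at_top"
    proof (rule filterlim_at_top_mono)
      show "filterlim (\<lambda>s. c * d s) at_top at_top"
        using assms by (intro filterlim_tendsto_pos_mult_at_top[OF tendsto_const] \<rho>.unbounded)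
      show "\<forall>\<^sub>F s in at_top. c * d s \<le> \<kappa> * (deriv \<phi> (B * s) * B) + c * d s"
        using eventually_gt_at_top[of 0] by eventually_elim (use assms deriv_nonneg in auto)
    qed
  qed
qed

section \<open>The minimiser and the minimum as functions of the circuit power\<close>

theorem theorem4:
  fixes B \<sigma> \<xi> \<kappa> :: real and \<phi> :: "real \<Rightarrow> real" and ch :: "'a channel"
  assumes "0 < B" and "0 < \<sigma>\<^sup>2" and "0 < \<xi>" and "0 \<le> \<kappa>"
    and "\<phi> 0 = 0"
    and "\<phi> differentiable_on {0..}"
    and "strict_mono_on {0..} \<phi>"
    and "convex_on {0..} \<phi>"
    and "valid_channel ch"
  shows "strict_mono_on {0<..} (\<lambda>Pc. E_star B \<sigma> \<xi> \<kappa> \<phi> ch Pc) \<and>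
    strict_mono_on {0<..} (\<lambda>Pc. s_star B \<sigma> \<xi> \<kappa> \<phi> ch Pc) \<and>
    filterlim (\<lambda>Pc. s_star B \<sigma> \<xi> \<kappa> \<phi> ch Pc) at_top at_top \<and>
    ((\<lambda>Pc. s_star B \<sigma> \<xi> \<kappa> \<phi> ch Pc) \<longlongrightarrow> 0) (at_right 0)"
proof -
  define h where "h s = \<kappa> * \<phi> (B * s) + \<sigma>\<^sup>2 / \<xi> * rho ch s" for s
  obtain d\<^sub>\<rho> where "strict_subgradient (rho ch) d\<^sub>\<rho>"
    using strict_subgradient_channel assms by blast
  then obtain d where "strict_subgradient h d"
    using strict_subgradient_add_convex[of "rho ch" d\<^sub>\<rho> B \<kappa> "\<sigma>\<^sup>2 / \<xi>" \<phi>] assms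
    unfolding h_def by (auto intro: strict_mono_on_imp_mono_on)
  then interpret strict_subgradient h d .
  let ?E = "energy_per_bit B \<sigma> \<xi> \<kappa> \<phi> ch" and ?s = "s_star B \<sigma> \<xi> \<kappa> \<phi> ch"
  have E: "?E Pc t = ereal ((h t + Pc) / (B * t))" if "0 < t" for Pc t
    using that by (simp add: energy_per_bit_def total_power_def h_def)
  \<comment> \<open>The operating point \<open>s\<close> serves as the parameter in place of
    \<open>Pc\<close>: for \<open>Pc = intercept s\<close> the total power at \<open>s\<close> is
    exactly \<open>s * d s\<close>.\<close>
  have E_opt: "?E (intercept s) s = ereal (d s / B)" if "0 < s" for s
    using that \<open>0 < B\<close> by (simp add: E intercept_def)
  \<comment> \<open>\<open>line_le\<close> divided by \<open>B * t\<close> makes \<open>s\<close>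
    the unique minimiser; at \<open>t = 0\<close> the energy is infinite.\<close>
  have E_less: "ereal (d s / B) < ?E (intercept s) t" if "0 < s" "0 \<le> t" "t \<noteq> s" for s t
  proof (cases "t = 0")
    case True
    then show ?thesis
      by (simp add: energy_per_bit_def)
  next
    case False
    then have "d s / B < (h t + intercept s) / (B * t)"
      using line_le[OF that] that \<open>0 < B\<close> by (simp add: field_simps)
    then show ?thesis
      using False that by (simp add: E)
  qed
  have s_star_intercept: "?s (intercept s) = s" if s: "0 < s" for s
    unfolding s_star_def
  proof (rule the_equality)
    have "\<not> ?E (intercept s) t < ?E (intercept s) s" if "0 \<le> t" for t
      using E_less[OF s that] E_opt[OF s] by (cases "t = s") (auto dest: order_less_asym)
    then show "is_arg_min (?E (intercept s)) (\<lambda>s. 0 \<le> s) s"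
      using s by (auto simp: is_arg_min_def)
    fix t assume t: "is_arg_min (?E (intercept s)) (\<lambda>s. 0 \<le> s) t"
    show "t = s"
    proof (rule ccontr)
      assume "t \<noteq> s"
      then have "?E (intercept s) s < ?E (intercept s) t"
        using t E_less[OF s] E_opt[OF s] by (simp add: is_arg_min_def)
      then show False
        using t s unfolding is_arg_min_def by (meson less_imp_le)
    qed
  qed
  have E_star_intercept: "E_star B \<sigma> \<xi> \<kappa> \<phi> ch (intercept s) = ereal (d s / B)" if s: "0 < s" for s
    unfolding E_star_def
  proof (rule Least_equality)
    show "\<exists>t\<ge>0. ereal (d s / B) = ?E (intercept s) t"
      using E_opt[OF s] s by (intro exI[of _ s]) auto
    show "ereal (d s / B) \<le> e" if "\<exists>t\<ge>0. e = ?E (intercept s) t" for e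
      using that E_opt[OF s] E_less[OF s] by (metis order_le_less)
  qed
  have s_star: "0 < ?s Pc" "intercept (?s Pc) = Pc" if "0 < Pc" for Pc
    using intercept_surj[OF that] s_star_intercept by auto
  \<comment> \<open>Since \<open>?s\<close> inverts the increasing \<open>intercept\<close>, bounds
    on the minimiser become bounds on \<open>Pc\<close>, from which both limits are read
    off.\<close>
  have s_star_less_iff: "?s Pc < t \<longleftrightarrow> Pc < intercept t" "t < ?s Pc \<longleftrightarrow> intercept t < Pc"
    if "0 < Pc" "0 < t" for Pc t
    using intercept_less_iff[of "?s Pc" t] intercept_less_iff[of t "?s Pc"] s_star[OF that(1)] that
    by auto
  have s_star_mono: "?s Pc < ?s Pc'" if "0 < Pc" "Pc < Pc'" for Pc Pc'
    using s_star_less_iff(1)[of Pc "?s Pc'"] s_star[of Pc'] that by simp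
  have "strict_mono_on {0<..} (\<lambda>Pc. E_star B \<sigma> \<xi> \<kappa> \<phi> ch Pc)"
  proof (rule strict_mono_onI)
    fix Pc Pc' :: real assume P: "Pc \<in> {0<..}" "Pc' \<in> {0<..}" "Pc < Pc'"
    have E_star: "E_star B \<sigma> \<xi> \<kappa> \<phi> ch P = ereal (d (?s P) / B)" if "0 < P" for P
      using E_star_intercept[of "?s P"] s_star[OF that] by simp
    have "d (?s Pc) < d (?s Pc')"
      using P s_star s_star_mono by (intro strict) auto
    then show "E_star B \<sigma> \<xi> \<kappa> \<phi> ch Pc < E_star B \<sigma> \<xi> \<kappa> \<phi> ch Pc'"
      using P \<open>0 < B\<close> by (simp add: E_star divide_strict_right_mono)
  qed
  moreover have "strict_mono_on {0<..} ?s"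
    using s_star_mono by (intro strict_mono_onI) auto
  moreover have "filterlim ?s at_top at_top"
    unfolding filterlim_at_top
  proof
    fix Z
    show "\<forall>\<^sub>F Pc in at_top. Z \<le> ?s Pc"
      \<comment> \<open>The \<open>max 1\<close> provides a positive comparison point even when
        \<open>Z\<close> is not positive.\<close>
      using eventually_gt_at_top[of "intercept (max 1 Z)"] eventually_gt_at_top[of 0]
    proof eventually_elim
      case (elim Pc)
      then have "max 1 Z < ?s Pc"
        by (subst s_star_less_iff) auto
      then show ?case by simp
    qed
  qed
  moreover have "(?s \<longlongrightarrow> 0) (at_right 0)"
  proof (rule order_tendstoI)
    fix a :: real
    show "\<forall>\<^sub>F Pc in at_right 0. a < ?s Pc" if "a < 0"
      using eventually_at_right_less[of "0::real"] by eventually_elim (use s_star that in force)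
    show "\<forall>\<^sub>F Pc in at_right 0. ?s Pc < a" if "0 < a"
      using eventually_at_right_less[of "0::real"]
        eventually_at_right_real[OF intercept_pos[OF that]]
      by eventually_elim (use s_star_less_iff that in auto)
  qed
  ultimately show ?thesis
    by blast
qed

end
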